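(* Let $\mathcal{H}$ and $\mathcal{G}$ be real finite-dimensional Hilbert spaces, let $g:\mathcal{H}\to\overline{\mathbb{R}}$ and $h:\mathcal{G}\to\overline{\mathbb{R}}$ be proper, convex and lower semicontinuous, let $\varphi:\mathcal{H}\to\mathbb{R}$ be convex and Fréchet differentiable with $\frac1\beta$-Lipschitz continuous gradient for some $\beta>0$, and let $K:\mathcal{H}\to\mathcal{G}$ be linear with adjoint $K^*$. Let $(\gamma_n)_{n\ge0}$ and $(\mu_n)_{n\ge0}$ be sequences of positive numbers with $$0<\inf_{n\ge0}\gamma_n\le\sup_{n\ge0}\gamma_n<2\beta\quad\text{and}\quad0<\inf_{n\ge0}\mu_n\le\sup_{n\ge0}\mu_n<+\infty,$$ let $(x_0,y_0)\in\mathcal{H}\times\mathcal{G}$, and for $n\ge0$ let $$x_{n+1}=\operatorname{Prox}_{\gamma_n g}\big(x_n+\gamma_nK^*y_n-\gamma_n\nabla\varphi(x_n)\big),\qquad y_{n+1}=\operatorname{Prox}_{\mu_nh^*}\big(y_n+\mu_nKx_{n+1}\big).$$ Assume $\inf\{g(x)+\varphi(x)-h(Kx):x\in\mathcal{H}\}>-\infty$. If $(x_n)_{n\ge0}$ and $(y_n)_{n\ge0}$ are bounded, then: 1. every cluster point $\bar x$ of $(x_n)_{n\ge0}$ is a critical point of $g+\varphi-h\circ K$; 2. every cluster point $\bar y$ of $(y_n)_{n\ge0}$ is a critical point of $h^*-(g+\varphi)^*\circ K^*$; 3. every cluster point $(\bar x,\bar y)$ of $(x_n,y_n)_{n\ge0}$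 is a critical point of $\Phi$, where $\Phi(x,y)=g(x)+\varphi(x)+h^*(y)-\langle y,Kx\rangle$.
   Context: $\overline{\mathbb{R}}=\mathbb{R}\cup\{+\infty,-\infty\}$, with the convention $+\infty-\infty=+\infty$. A function is proper if it never takes the value $-\infty$ and is not identically $+\infty$. The conjugate of $f$ is $f^*(x^* )=\sup_x\{\langle x^*,x\rangle-f(x)\}$; $\partial$ denotes the convex subdifferential (empty outside the domain $\{f<+\infty\}$). For $f$ proper, convex and lower semicontinuous and $\gamma>0$, $\operatorname{Prox}_{\gamma f}(x)$ is the unique minimizer over $y$ of $\gamma f(y)+\frac12\|y-x\|^2$. Critical points: $x\in\mathcal{H}$ is a critical point of $g+\varphi-h\circ K$ if $K^*\partial h(Kx)\cap(\partial g(x)+\nabla\varphi(x))\ne\emptyset$. $y\in\mathcal{G}$ is a critical point of $h^*-(g+\varphi)^*\circ K^*$ if $K\,\partial(g+\varphi)^*(K^*y)\cap\partial h^*(y)\ne\emptyset$. $(\bar x,\bar y)\in\mathcal{H}\times\mathcal{G}$ is a critical point of $\Phi$ if $K^*\bar y\in\partial g(\bar x)+\nabla\varphi(\bar x)$ and $K\bar x\in\partial h^*(\bar y)$. *)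

theory Defs
  imports "HOL-Analysis.Analysis"
begin

text \<open>
  Extended real-valued functions take values in \<^typ>\<open>ereal\<close>, whose addition satisfies
  \<open>\<infinity> + (-\<infinity>) = \<infinity>\<close>. This is the convention used for \<open>\<infinity> - \<infinity>\<close> throughout.
\<close>

definition ereal_proper :: "('a \<Rightarrow> ereal) \<Rightarrow> bool"
  where "ereal_proper f \<longleftrightarrow> (\<forall>x. f x \<noteq> -\<infinity>) \<and> (\<exists>x. f x \<noteq> \<infinity>)"

definition ereal_convex :: "('a::real_vector \<Rightarrow> ereal) \<Rightarrow> bool"
  where "ereal_convex f \<longleftrightarrow>
    (\<forall>x y. \<forall>u\<ge>0. \<forall>v\<ge>0. u + v = 1 \<longrightarrow>
      f (u *\<^sub>R x + v *\<^sub>R y) \<le> ereal u * f x + ereal v * f y)"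

definition ereal_lsc :: "('a::topological_space \<Rightarrow> ereal) \<Rightarrow> bool"
  where "ereal_lsc f \<longleftrightarrow> (\<forall>x. f x \<le> Liminf (nhds x) f)"

definition conjugate :: "('a::real_inner \<Rightarrow> ereal) \<Rightarrow> 'a \<Rightarrow> ereal"
  where "conjugate f u = (SUP x. ereal (u \<bullet> x) - f x)"

definition subdifferential :: "('a::real_inner \<Rightarrow> ereal) \<Rightarrow> 'a \<Rightarrow> 'a set"
  where "subdifferential f x =
    {u. f x < \<infinity> \<and> (\<forall>z. f x + ereal (u \<bullet> (z - x)) \<le> f z)}"

text \<open>
  The operators \<open>prox\<close> and \<open>gradient\<close> are definite descriptions: \<open>prox\<close> is meaningful
  for proper, convex, lower semicontinuous \<open>f\<close> and \<open>\<gamma> > 0\<close>, and \<open>gradient\<close> at points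
  where \<open>f\<close> is differentiable.
\<close>

definition prox :: "real \<Rightarrow> ('a::real_inner \<Rightarrow> ereal) \<Rightarrow> 'a \<Rightarrow> 'a"
  where "prox \<gamma> f x =
    (THE y. \<forall>z. ereal \<gamma> * f y + ereal ((norm (y - x))\<^sup>2 / 2)
               \<le> ereal \<gamma> * f z + ereal ((norm (z - x))\<^sup>2 / 2))"

definition gradient :: "('a::real_inner \<Rightarrow> real) \<Rightarrow> 'a \<Rightarrow> 'a"
  where "gradient f x = (THE d. GDERIV f x :> d)"

definition cluster_point :: "(nat \<Rightarrow> 'a::metric_space) \<Rightarrow> 'a \<Rightarrow> bool"
  where "cluster_point X l \<longleftrightarrow> (\<exists>r. strict_mono r \<and> (X \<circ> r) \<longlonglongrightarrow> l)"

text \<open>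
  Critical points of the primal objective \<open>g + \<phi> - h \<circ> K\<close>, of the dual objective
  \<open>h\<^sup>* - (g + \<phi>)\<^sup>* \<circ> K\<^sup>*\<close>, and of the primal-dual objective
  \<open>\<Phi>(x, y) = g(x) + \<phi>(x) + h\<^sup>*(y) - \<langle>y, K x\<rangle>\<close>. These notions refer to the
  decomposition of the objective and not only to its values, hence the parameters.
\<close>

definition primal_critical ::
  "('h::real_inner \<Rightarrow> ereal) \<Rightarrow> ('h \<Rightarrow> real) \<Rightarrow> ('g::real_inner \<Rightarrow> ereal) \<Rightarrow> ('h \<Rightarrow> 'g) \<Rightarrow> 'h \<Rightarrow> bool"
  where "primal_critical g \<phi> h K x \<longleftrightarrow>
    adjoint K ` subdifferential h (K x)
      \<inter> (\<lambda>v. v + gradient \<phi> x) ` subdifferential g x \<noteq> {}"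

definition dual_critical ::
  "('h::real_inner \<Rightarrow> ereal) \<Rightarrow> ('h \<Rightarrow> real) \<Rightarrow> ('g::real_inner \<Rightarrow> ereal) \<Rightarrow> ('h \<Rightarrow> 'g) \<Rightarrow> 'g \<Rightarrow> bool"
  where "dual_critical g \<phi> h K y \<longleftrightarrow>
    K ` subdifferential (conjugate (\<lambda>x. g x + ereal (\<phi> x))) (adjoint K y)
      \<inter> subdifferential (conjugate h) y \<noteq> {}"

definition primal_dual_critical ::
  "('h::real_inner \<Rightarrow> ereal) \<Rightarrow> ('h \<Rightarrow> real) \<Rightarrow> ('g::real_inner \<Rightarrow> ereal) \<Rightarrow> ('h \<Rightarrow> 'g) \<Rightarrow> 'h \<times> 'g \<Rightarrow> bool"
  where "primal_dual_critical g \<phi> h K = (\<lambda>(x, y).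
    adjoint K y \<in> (\<lambda>v. v + gradient \<phi> x) ` subdifferential g x
      \<and> K x \<in> subdifferential (conjugate h) y)"

end

theory Submission
  imports Defs
begin

text \<open>
  The proximal steps put \<open>u\<^sub>n = (x\<^sub>n - x\<^sub>n\<^sub>+\<^sub>1)/\<gamma>\<^sub>n + K\<^sup>*y\<^sub>n - \<nabla>\<phi>(x\<^sub>n)\<close> in \<open>\<partial>g(x\<^sub>n\<^sub>+\<^sub>1)\<close> and
  \<open>v\<^sub>n = (y\<^sub>n - y\<^sub>n\<^sub>+\<^sub>1)/\<mu>\<^sub>n + Kx\<^sub>n\<^sub>+\<^sub>1\<close> in \<open>\<partial>h\<^sup>*(y\<^sub>n\<^sub>+\<^sub>1)\<close>. Together with the descent lemma for
  \<open>\<phi>\<close>, the two subgradient inequalities make \<open>\<Phi>(x\<^sub>n, y\<^sub>n)\<close> decrease by a fixed multiple of the squared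
  step lengths (here \<open>\<gamma>\<^sub>n < 2\<beta>\<close> enters), and \<open>\<Phi>\<close> is bounded below by the primal infimum. Hence
  the steps tend to 0, so \<open>u\<^sub>n\<close> and \<open>v\<^sub>n\<close> converge along subsequences to \<open>K\<^sup>*y - \<nabla>\<phi>(x)\<close> and \<open>Kx\<close>,
  and the closed graphs of the subdifferentials give critical points of \<open>\<Phi>\<close>. Cluster points
  of one sequence are completed to joint ones by boundedness of the other.
\<close>

subsection \<open>Inner product spaces of finite dimension\<close>

text \<open>Gram-Schmidt makes the given finite spanning set orthogonal; dropping 0 and normalising
  yields an orthonormal basis, the source of all coordinates below.\<close>

lemma orthonormal_spanning_set:
  assumes "\<exists>B. finite B \<and> span B = (UNIV :: 'a::real_inner set)"
  obtains B :: "'a::real_inner set" where "finite B" "\<And>b. b \<in> B \<Longrightarrow> norm b = 1"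
    "\<And>x. (\<Sum>b\<in>B. (x \<bullet> b) *\<^sub>R b) = x"
proof -
  obtain B0 :: "'a set" where "finite B0" "span B0 = UNIV"
    using assms by blast
  then obtain C :: "'a set" where C: "finite C" "span C = UNIV" "pairwise orthogonal C"
    using basis_orthogonal by metis
  define B where "B = sgn ` (C - {0})"
  have norm_B: "norm b = 1" if "b \<in> B" for b
    using that by (auto simp: B_def norm_sgn split: if_splits)
  have orth: "pairwise orthogonal B"
  proof (rule pairwiseI)
    fix a b assume "a \<in> B" "b \<in> B" "a \<noteq> b"
    then obtain c d where "c \<in> C" "d \<in> C" "a = sgn c" "b = sgn d" "c \<noteq> d"
      by (auto simp: B_def)
    then show "orthogonal a b"
      using C(3) by (auto simp: pairwise_def orthogonal_def sgn_div_norm)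
  qed
  have "c \<in> span B" if "c \<in> C" for c
  proof (cases "c = 0")
    case False
    then have "sgn c \<in> B" using that by (auto simp: B_def)
    then have "norm c *\<^sub>R sgn c \<in> span B" by (simp add: span_base span_scale)
    then show ?thesis using False by (simp add: sgn_div_norm)
  qed (simp add: span_zero)
  then have "span B = UNIV"
    using C(2) by (metis span_span span_mono subsetI top.extremum_uniqueI)
  moreover have "finite B" using C(1) by (simp add: B_def)
  ultimately show thesis
    using that[of B] norm_B orthonormal_basis_expand[OF orth norm_B] by blast
qed

lemma riesz_representation_finite_dim:
  fixes f :: "'a::real_inner \<Rightarrow> real"
  assumes fd: "\<exists>B. finite B \<and> span B = (UNIV :: 'a set)" and "linear f"
  obtains d where "\<And>x. f x = x \<bullet> d"
proof -
  obtain B :: "'a set" where B: "\<And>x. (\<Sum>b\<in>B. (x \<bullet> b) *\<^sub>R b) = x"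
    using orthonormal_spanning_set[OF fd] by metis
  \<comment> \<open>The coordinates of the representing vector are the values of \<open>f\<close> on
    the basis.\<close>
  have "f x = x \<bullet> (\<Sum>b\<in>B. f b *\<^sub>R b)" for x
  proof -
    have "f x = f (\<Sum>b\<in>B. (x \<bullet> b) *\<^sub>R b)" by (simp add: B)
    also have "\<dots> = (\<Sum>b\<in>B. (x \<bullet> b) * f b)"
      using \<open>linear f\<close> by (simp add: linear_sum linear_scale)
    finally show ?thesis by (simp add: inner_sum_right mult.commute)
  qed
  then show thesis by (rule that)
qed

lemma bounded_linear_finite_dim:
  fixes f :: "'a::real_inner \<Rightarrow> 'b::real_normed_vector"
  assumes fd: "\<exists>B. finite B \<and> span B = (UNIV :: 'a set)" and "linear f"
  shows "bounded_linear f"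
proof -
  obtain B :: "'a set" where B: "\<And>x. (\<Sum>b\<in>B. (x \<bullet> b) *\<^sub>R b) = x" "\<And>b. b \<in> B \<Longrightarrow> norm b = 1"
    using orthonormal_spanning_set[OF fd] by metis
  have "norm (f x) \<le> norm x * (\<Sum>b\<in>B. norm (f b))" for x
  proof -
    have "f x = f (\<Sum>b\<in>B. (x \<bullet> b) *\<^sub>R b)" by (simp add: B)
    also have "\<dots> = (\<Sum>b\<in>B. (x \<bullet> b) *\<^sub>R f b)"
      using \<open>linear f\<close> by (simp add: linear_sum linear_scale)
    also have "norm \<dots> \<le> (\<Sum>b\<in>B. norm x * norm (f b))"
    proof (rule sum_norm_le)
      fix b assume "b \<in> B"
      then have "\<bar>x \<bullet> b\<bar> \<le> norm x"
        using Cauchy_Schwarz_ineq2[of x b] B(2) by simp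
      then show "norm ((x \<bullet> b) *\<^sub>R f b) \<le> norm x * norm (f b)"
        by (simp add: mult_right_mono)
    qed
    finally show ?thesis by (simp add: sum_distrib_left)
  qed
  then show ?thesis
    using \<open>linear f\<close> by (auto simp: bounded_linear_def bounded_linear_axioms_def)
qed

text \<open>\<open>adjoint\<close> is defined by choice, so its identity holds once some adjoint
  exists. Riesz representation of \<open>\<lambda>x. f x \<bullet> y\<close>, for each
  \<open>y\<close>, supplies one.\<close>

lemma adjoint_works_finite_dim:
  fixes f :: "'a::real_inner \<Rightarrow> 'b::real_inner"
  assumes fd: "\<exists>B. finite B \<and> span B = (UNIV :: 'a set)" and "linear f"
  shows "x \<bullet> adjoint f y = f x \<bullet> y"
proof -
  have "\<exists>w. \<forall>x. f x \<bullet> y = x \<bullet> w" for y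
  proof -
    have "linear (\<lambda>x. f x \<bullet> y)"
      using \<open>linear f\<close> by (simp add: linear_iff inner_add_left)
    then show ?thesis
      using riesz_representation_finite_dim[OF fd] by metis
  qed
  then obtain f' where "\<forall>x y. f x \<bullet> y = x \<bullet> f' y" by metis
  then show ?thesis
    using adjoint_unique by metis
qed

lemma adjoint_linear_finite_dim:
  fixes f :: "'a::real_inner \<Rightarrow> 'b::real_inner"
  assumes fd: "\<exists>B. finite B \<and> span B = (UNIV :: 'a set)" and "linear f"
  shows "linear (adjoint f)"
proof (rule linearI)
  fix u v :: 'b and c :: real
  have "x \<bullet> adjoint f (u + v) = x \<bullet> (adjoint f u + adjoint f v)" for x
    by (simp add: adjoint_works_finite_dim[OF assms] inner_add_right)
  then show "adjoint f (u + v) = adjoint f u + adjoint f v"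
    using vector_eq_ldot by blast
  have "x \<bullet> adjoint f (c *\<^sub>R u) = x \<bullet> (c *\<^sub>R adjoint f u)" for x
    by (simp add: adjoint_works_finite_dim[OF assms])
  then show "adjoint f (c *\<^sub>R u) = c *\<^sub>R adjoint f u"
    using vector_eq_ldot by blast
qed

text \<open>Prepares Heine-Borel. Each new vector contributes a segment, and the Minkowski sum of
  two compact sets is compact.\<close>

lemma bounded_coefficients_in_compact:
  fixes B :: "'a::real_normed_vector set"
  assumes "finite B"
  shows "\<exists>T. compact T \<and> (\<forall>c. (\<forall>b\<in>B. \<bar>c b\<bar> \<le> r) \<longrightarrow> (\<Sum>b\<in>B. c b *\<^sub>R b) \<in> T)"
  using assms
proof induction
  case empty
  show ?case by (intro exI[of _ "{0}"]) simp
next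
  case (insert b B)
  then obtain T where T: "compact T"
    "\<And>c. (\<forall>b\<in>B. \<bar>c b\<bar> \<le> r) \<Longrightarrow> (\<Sum>b\<in>B. c b *\<^sub>R b) \<in> T"
    by blast
  let ?I = "(\<lambda>t. t *\<^sub>R b) ` {-r..r}"
  have "compact ?I"
    by (intro compact_continuous_image continuous_intros compact_Icc)
  then have "compact {x + y | x y. x \<in> ?I \<and> y \<in> T}"
    using T(1) by (rule compact_sums)
  moreover have "(\<Sum>a\<in>insert b B. c a *\<^sub>R a) \<in> {x + y | x y. x \<in> ?I \<and> y \<in> T}"
    if "\<forall>a\<in>insert b B. \<bar>c a\<bar> \<le> r" for c
  proof -
    have "c b *\<^sub>R b \<in> ?I" "(\<Sum>a\<in>B. c a *\<^sub>R a) \<in> T"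
      using that T(2)[of c] by (auto simp: abs_le_iff)
    then show ?thesis using insert.hyps by auto
  qed
  ultimately show ?case by blast
qed

text \<open>By Cauchy-Schwarz, a norm bound on \<open>S\<close> also bounds all orthonormal
  coordinates, so \<open>S\<close> is a closed subset of a compact set.\<close>

lemma closed_bounded_imp_compact_finite_dim:
  fixes S :: "'a::real_inner set"
  assumes fd: "\<exists>B. finite B \<and> span B = (UNIV :: 'a set)" and "closed S" "bounded S"
  shows "compact S"
proof -
  obtain B :: "'a set" where B: "finite B" "\<And>b. b \<in> B \<Longrightarrow> norm b = 1"
    "\<And>x. (\<Sum>b\<in>B. (x \<bullet> b) *\<^sub>R b) = x"
    using orthonormal_spanning_set[OF fd] by metis
  obtain r where r: "\<And>x. x \<in> S \<Longrightarrow> norm x \<le> r"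
    using \<open>bounded S\<close> by (auto simp: bounded_iff)
  obtain T where T: "compact T"
    "\<And>c. (\<forall>b\<in>B. \<bar>c b\<bar> \<le> r) \<Longrightarrow> (\<Sum>b\<in>B. c b *\<^sub>R b) \<in> T"
    using bounded_coefficients_in_compact[OF B(1)] by metis
  have "x \<in> T" if "x \<in> S" for x
  proof -
    have "\<bar>x \<bullet> b\<bar> \<le> r" if "b \<in> B" for b
      using Cauchy_Schwarz_ineq2[of x b] B(2)[OF that] r[OF \<open>x \<in> S\<close>] by simp
    then show ?thesis using T(2)[of "\<lambda>b. x \<bullet> b"] B(3) by simp
  qed
  then have "S = T \<inter> S" by blast
  then show ?thesis using T(1) \<open>closed S\<close> by (metis compact_Int_closed)
qed

lemma bounded_imp_convergent_subsequence_finite_dim: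
  fixes X :: "nat \<Rightarrow> 'a::real_inner"
  assumes fd: "\<exists>B. finite B \<and> span B = (UNIV :: 'a set)" and "bounded (range X)"
  obtains l r where "strict_mono r" "(X \<circ> r) \<longlonglongrightarrow> l"
proof -
  have "compact (closure (range X))"
    using closed_bounded_imp_compact_finite_dim[OF fd] assms(2) bounded_closure by blast
  then have "seq_compact (closure (range X))"
    by (rule compact_imp_seq_compact)
  moreover have "\<forall>n. X n \<in> closure (range X)"
    by (simp add: closure_subset[THEN subsetD])
  ultimately show thesis
    using that by (meson seq_compactE)
qed

subsection \<open>Subdifferentials and semicontinuity\<close>

lemma subdifferentialI:
  assumes "f x < \<infinity>" "\<And>z. f x + ereal (u \<bullet> (z - x)) \<le> f z"
  shows "u \<in> subdifferential f x"
  using assms by (simp add: subdifferential_def)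

lemma subdifferentialD:
  assumes "u \<in> subdifferential f x"
  shows "f x < \<infinity>" "f x + ereal (u \<bullet> (z - x)) \<le> f z"
  using assms by (simp_all add: subdifferential_def)

lemma ereal_proper_finite:
  assumes "ereal_proper f" "f x < \<infinity>"
  obtains r where "f x = ereal r"
  using assms by (cases "f x") (auto simp: ereal_proper_def)

text \<open>Weierstrass: without a minimal point, the sets \<open>{p. f z < f p}\<close>, open by
  semicontinuity, would cover \<open>S\<close>. In a finite subcover, the index \<open>z\<close>
  with the least \<open>f z\<close> lies in none of the sets.\<close>

lemma ereal_lsc_attains_inf:
  fixes f :: "'a::topological_space \<Rightarrow> ereal"
  assumes "ereal_lsc f" "compact S" "S \<noteq> {}"
  shows "\<exists>p\<in>S. \<forall>z\<in>S. f p \<le> f z"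
proof (rule ccontr)
  assume "\<not> ?thesis"
  then have less: "\<forall>p\<in>S. \<exists>z\<in>S. f z < f p" by (simp add: not_le)
  have op: "open {p. f z < f p}" for z
  proof (subst open_subopen, safe)
    fix p assume "f z < f p"
    then have "f z < Liminf (nhds p) f"
      using assms(1) by (auto simp: ereal_lsc_def intro: less_le_trans)
    then have "eventually (\<lambda>q. f z < f q) (nhds p)"
      by (rule less_LiminfD)
    then show "\<exists>T. open T \<and> p \<in> T \<and> T \<subseteq> {p. f z < f p}"
      by (auto simp: eventually_nhds)
  qed
  have "S \<subseteq> (\<Union>z\<in>S. {p. f z < f p})" using less by blast
  then obtain Z where Z: "Z \<subseteq> S" "finite Z" "S \<subseteq> (\<Union>z\<in>Z. {p. f z < f p})"
    using compactE_image[OF assms(2), of S "\<lambda>z. {p. f z < f p}"] op by metis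
  with assms(3) have "Z \<noteq> {}" by auto
  with Z(2) obtain z where z: "z \<in> Z" "\<And>w. w \<in> Z \<Longrightarrow> f z \<le> f w"
    using ex_min_if_finite[of "f ` Z"] by (force simp: not_less)
  then show False using Z by (force simp: not_le[symmetric])
qed

lemma ereal_lsc_mult_add_continuous:
  fixes f :: "'a::topological_space \<Rightarrow> ereal"
  assumes lsc: "ereal_lsc f" and "c \<ge> 0" and q: "continuous_on UNIV q"
  shows "ereal_lsc (\<lambda>z. ereal c * f z + ereal (q z))"
  unfolding ereal_lsc_def le_Liminf_iff
proof safe
  fix p s assume s: "s < ereal c * f p + ereal (q p)"
  have "ereal c * f p \<le> Liminf (nhds p) (\<lambda>z. ereal c * f z)"
    using lsc assms(2) by (simp add: Liminf_ereal_mult_left ereal_lsc_def ereal_mult_left_mono)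
  then have below: "eventually (\<lambda>z. l < ereal c * f z) (nhds p)" if "l < ereal c * f p" for l
    using that by (intro less_LiminfD) (rule less_le_trans)
  \<comment> \<open>A real \<open>t\<close> leaves room even if \<open>s\<close> is
    \<open>-\<infinity>\<close>. It is split as \<open>t' + (t - t')\<close>, with \<open>t'\<close>
    below the first summand at \<open>p\<close> and \<open>t - t'\<close> below the second; both
    bounds persist nearby.\<close>
  obtain t where t: "s < ereal t" "ereal t < ereal c * f p + ereal (q p)"
    using s ereal_dense2 by blast
  then have "ereal (t - q p) < ereal c * f p"
    by (cases "ereal c * f p") auto
  then obtain t' where t': "t - q p < t'" "ereal t' < ereal c * f p"
    by (metis ereal_dense2 less_ereal.simps(1))
  have "(q \<longlongrightarrow> q p) (nhds p)"
    using q by (auto simp: continuous_on_def tendsto_nhds_iff)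
  then have "eventually (\<lambda>z. t - t' < q z) (nhds p)"
    using t'(1) by (intro order_tendstoD) auto
  with below[OF t'(2)] show "eventually (\<lambda>z. s < ereal c * f z + ereal (q z)) (nhds p)"
  proof eventually_elim
    case (elim z)
    have "s < ereal (t' + (t - t'))" using t(1) by simp
    also have "\<dots> \<le> ereal c * f z + ereal (q z)"
      using elim by (cases "ereal c * f z") auto
    finally show ?case .
  qed
qed

lemma nonpos_if_le_small_multiples:
  fixes a b :: real
  assumes "\<And>t. 0 < t \<Longrightarrow> t < 1 \<Longrightarrow> a \<le> t * b"
  shows "a \<le> 0"
proof (rule tendsto_lowerbound)
  show "((\<lambda>t. t * b) \<longlongrightarrow> 0) (at_right 0)"
    by (auto intro!: tendsto_eq_intros)
  show "eventually (\<lambda>t. a \<le> t * b) (at_right 0)"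
    using assms by (auto simp: eventually_at_right_field intro!: exI[of _ 1])
qed simp

text \<open>Add the two subgradient inequalities; the function values are finite and cancel.\<close>

lemma subdifferential_mono:
  assumes "ereal_proper f" "u \<in> subdifferential f x" "v \<in> subdifferential f y"
  shows "0 \<le> (u - v) \<bullet> (x - y)"
proof -
  obtain r s where rs: "f x = ereal r" "f y = ereal s"
    using ereal_proper_finite assms subdifferentialD(1) by metis
  have "r + u \<bullet> (y - x) \<le> s" "s + v \<bullet> (x - y) \<le> r"
    using subdifferentialD(2)[OF assms(2), of y] subdifferentialD(2)[OF assms(3), of x] rs by auto
  then show ?thesis by (simp add: inner_diff)
qed

text \<open>\<open>f (X n)\<close> need not converge to \<open>f x\<close>, but semicontinuity
  bounds \<open>f x\<close> by its lower limit. This is the right direction, since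
  \<open>f (X n)\<close> stands on the smaller side of the subgradient inequality and the inner
  products converge.\<close>

lemma subdifferential_closed_graph:
  assumes proper: "ereal_proper f" and lsc: "ereal_lsc f"
    and U: "U \<longlonglongrightarrow> u" and X: "X \<longlonglongrightarrow> x" and sub: "\<And>n. U n \<in> subdifferential f (X n)"
  shows "u \<in> subdifferential f x"
proof -
  have upper: "f x \<le> ereal (r - u \<bullet> (z - x))" if z: "f z = ereal r" for z r
  proof (rule ccontr)
    assume "\<not> ?thesis"
    then have "ereal (r - u \<bullet> (z - x)) < f x" by (simp add: not_le)
    then obtain t where t: "r - u \<bullet> (z - x) < t" "ereal t < f x"
      using ereal_dense2 less_ereal.simps(1) by metis
    have "eventually (\<lambda>q. ereal t < f q) (nhds x)"
      using lsc t(2) by (auto simp: ereal_lsc_def intro!: less_LiminfD intro: less_le_trans)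
    then have "eventually (\<lambda>n. ereal t < f (X n)) sequentially"
      using X by (rule eventually_compose_filterlim)
    then have "eventually (\<lambda>n. t \<le> r - U n \<bullet> (z - X n)) sequentially"
    proof eventually_elim
      case (elim n)
      then show ?case
        using subdifferentialD(2)[OF sub, of n z] z by (cases "f (X n)") auto
    qed
    moreover have "(\<lambda>n. r - U n \<bullet> (z - X n)) \<longlonglongrightarrow> r - u \<bullet> (z - x)"
      by (intro tendsto_intros U X)
    ultimately have "t \<le> r - u \<bullet> (z - x)"
      by (intro tendsto_lowerbound) auto
    with t(1) show False by simp
  qed
  show ?thesis
  proof (rule subdifferentialI)
    \<comment> \<open>Each \<open>X n\<close> lies in the domain; testing with such a point shows
      that \<open>x\<close> does too.\<close>
    obtain r z where "f z = ereal r"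
      using ereal_proper_finite proper subdifferentialD(1)[OF sub] by metis
    from upper[OF this] show "f x < \<infinity>" by auto
    show "f x + ereal (u \<bullet> (z - x)) \<le> f z" for z
    proof (cases "f z")
      case (real r)
      then show ?thesis using upper[OF real] by (cases "f x") auto
    next
      case MInf
      then show ?thesis using proper by (simp add: ereal_proper_def)
    qed simp
  qed
qed

subsection \<open>Proximal points\<close>

text \<open>A minimum over the unit ball around a point of the domain bounds \<open>f\<close> from below,
  and convexity along rays extends this bound with linear growth.\<close>

lemma ereal_convex_lower_growth:
  fixes f :: "'a::real_inner \<Rightarrow> ereal"
  assumes fd: "\<exists>B. finite B \<and> span B = (UNIV :: 'a set)"
    and f: "ereal_proper f" "ereal_convex f" "ereal_lsc f" and a: "f x = ereal a"
  obtains M where "0 \<le> M" "\<And>z. ereal (a - M * (1 + norm (z - x))) \<le> f z"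
proof -
  have "compact (cball x 1)"
    by (intro closed_bounded_imp_compact_finite_dim[OF fd]) auto
  then obtain p where p: "\<And>z. z \<in> cball x 1 \<Longrightarrow> f p \<le> f z"
    using ereal_lsc_attains_inf[OF f(3), of "cball x 1"] by force
  obtain m where m: "f p = ereal m"
    using p[of x] a f(1) by (cases "f p") (auto simp: ereal_proper_def)
  have M: "m \<le> a" using p[of x] a m by simp
  have "ereal (a - (a - m) * (1 + norm (z - x))) \<le> f z" for z
  proof (cases "norm (z - x) \<le> 1")
    case True
    then have "ereal m \<le> f z" using p[of z] m by (simp add: dist_norm norm_minus_commute)
    moreover have "(a - m) * norm (z - x) \<ge> 0" using M by simp
    then have "a - (a - m) * (1 + norm (z - x)) \<le> m" by (simp add: algebra_simps)
    ultimately show ?thesis by (meson ereal_less_eq(3) order_trans)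
  next
    case False
    define r where "r = norm (z - x)"
    have r: "r > 1" using False by (simp add: r_def)
    \<comment> \<open>\<open>w\<close> is where the segment from \<open>x\<close> to
      \<open>z\<close> crosses the unit sphere around \<open>x\<close>. Solving the convexity
      inequality at \<open>w\<close> for \<open>f z\<close> gives the bound
      \<open>a - (a - m) * r\<close>, slightly more than required.\<close>
    define w where "w = (1 - 1 / r) *\<^sub>R x + (1 / r) *\<^sub>R z"
    have "w - x = (1 / r) *\<^sub>R (z - x)"
      by (simp add: w_def algebra_simps)
    then have "norm (w - x) = 1" using r by (auto simp: r_def)
    then have "ereal m \<le> f w" using p[of w] m by (simp add: dist_norm norm_minus_commute)
    also have "f w \<le> ereal (1 - 1 / r) * f x + ereal (1 / r) * f z"
      unfolding w_def using f(2) r by (simp add: ereal_convex_def)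
    finally have le: "ereal m \<le> ereal (1 - 1 / r) * ereal a + ereal (1 / r) * f z"
      by (simp add: a)
    show ?thesis
    proof (cases "f z")
      case (real e)
      have "m \<le> (1 - 1 / r) * a + e / r" using le real by simp
      then have "r * m \<le> r * ((1 - 1 / r) * a + e / r)" using r by simp
      also have "\<dots> = (r - 1) * a + e" using r by (simp add: field_simps)
      finally have "a - (a - m) * (1 + r) \<le> e" using M by (simp add: algebra_simps)
      then show ?thesis by (simp add: real r_def)
    next
      case MInf
      then show ?thesis using f(1) by (simp add: ereal_proper_def)
    qed simp
  qed
  then show thesis using that[of "a - m"] M by simp
qed

text \<open>Coercivity: \<open>f\<close> decreases at most linearly, so the quadratic term dominates
  far from \<open>x\<close>, and a minimizer over a large compact ball is global.\<close>

lemma prox_minimizer_exists: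
  fixes f :: "'a::real_inner \<Rightarrow> ereal"
  assumes fd: "\<exists>B. finite B \<and> span B = (UNIV :: 'a set)"
    and f: "ereal_proper f" "ereal_convex f" "ereal_lsc f" and c: "c > 0"
  obtains p where "\<And>z. ereal c * f p + ereal ((norm (p - x))\<^sup>2 / 2)
    \<le> ereal c * f z + ereal ((norm (z - x))\<^sup>2 / 2)"
proof -
  define F where "F z = ereal c * f z + ereal ((norm (z - x))\<^sup>2 / 2)" for z
  obtain x0 a where a: "f x0 = ereal a"
    using f(1) by (metis ereal_proper_def ereal_cases)
  obtain M where M: "0 \<le> M" "\<And>z. ereal (a - M * (1 + norm (z - x0))) \<le> f z"
    using ereal_convex_lower_growth[OF fd f a] by blast
  define d where "d = norm (x0 - x)"
  \<comment> \<open>For \<open>s > R\<close>, the part \<open>2 * (c * M) + 2\<close> gives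
    \<open>s\<^sup>2 / 2 - c * M * s \<ge> s\<close>, and the remaining terms let this
    \<open>s\<close> absorb the constants. The ball also contains \<open>x0\<close>, because
    \<open>d \<le> (1 + d\<^sup>2) / 2\<close>.\<close>
  define R where "R = 2 * (c * M) + 2 + c * M * (1 + d) + d\<^sup>2 / 2"
  have cM: "c * M \<ge> 0" "c * M * (1 + d) \<ge> 0" using c M(1) by (simp_all add: d_def)
  have far: "F x0 \<le> F z" if "z \<notin> cball x R" for z
  proof -
    define s where "s = norm (z - x)"
    have s: "s > R" using that by (simp add: s_def dist_norm norm_minus_commute)
    have "norm (z - x0) \<le> s + d"
      unfolding s_def d_def using norm_triangle_ineq4[of "z - x" "x0 - x"] by simp
    then have "M * (1 + norm (z - x0)) \<le> M * (1 + (s + d))"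
      using M(1) by (simp add: mult_left_mono)
    then have "ereal (a - M * (1 + (s + d))) \<le> f z"
      using M(2)[of z] by (meson diff_left_mono ereal_less_eq(3) order_trans)
    then have "ereal (c * (a - M * (1 + (s + d))) + s\<^sup>2 / 2) \<le> F z"
      using c by (cases "f z") (auto simp: F_def s_def)
    moreover have "c * a + d\<^sup>2 / 2 \<le> c * (a - M * (1 + (s + d))) + s\<^sup>2 / 2"
    proof -
      have s0: "s \<ge> 0" by (simp add: s_def)
      have "2 * (c * M) + 2 \<le> s"
        using s cM zero_le_power2[of d] unfolding R_def by linarith
      then have "s * 1 \<le> s * (s / 2 - c * M)"
        using s0 by (intro mult_left_mono) auto
      moreover have "c * M * (1 + d) + d\<^sup>2 / 2 \<le> s"
        using s cM unfolding R_def by linarith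
      ultimately show ?thesis by (simp add: algebra_simps power2_eq_square)
    qed
    then have "F x0 \<le> ereal (c * (a - M * (1 + (s + d))) + s\<^sup>2 / 2)"
      by (simp add: F_def a d_def)
    ultimately show ?thesis by (rule order_trans[rotated])
  qed
  have "2 * d \<le> 1 + d\<^sup>2"
    using zero_le_power2[of "d - 1"] by (simp add: power2_diff)
  then have x0: "x0 \<in> cball x R"
    using cM unfolding mem_cball dist_norm norm_minus_commute[of x] d_def[symmetric] R_def by linarith
  have "ereal_lsc F"
    unfolding F_def using f(3) c
    by (intro ereal_lsc_mult_add_continuous) (auto intro!: continuous_intros)
  moreover have "compact (cball x R)"
    by (intro closed_bounded_imp_compact_finite_dim[OF fd]) auto
  ultimately obtain p where p: "\<And>z. z \<in> cball x R \<Longrightarrow> F p \<le> F z"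
    using ereal_lsc_attains_inf[of F "cball x R"] x0 by blast
  have "F p \<le> F z" for z
    using p[of z] p[OF x0] far[of z] by (cases "z \<in> cball x R") (auto intro: order_trans)
  then show thesis using that[of p] by (simp add: F_def)
qed

text \<open>Fermat's rule: compare \<open>p\<close> with points at parameter \<open>t\<close> on the
  segment to \<open>z\<close>, divide by \<open>t\<close> and let \<open>t\<close> tend to 0; the
  quadratic error disappears. Stated for an arbitrary minimizer because uniqueness is derived from
  it.\<close>

lemma prox_minimizer_subgradient:
  fixes f :: "'a::real_inner \<Rightarrow> ereal"
  assumes f: "ereal_proper f" "ereal_convex f" and c: "c > 0"
    and min: "\<And>z. ereal c * f p + ereal ((norm (p - x))\<^sup>2 / 2)
      \<le> ereal c * f z + ereal ((norm (z - x))\<^sup>2 / 2)"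
  shows "(1 / c) *\<^sub>R (x - p) \<in> subdifferential f p"
proof -
  obtain x0 a where "f x0 = ereal a"
    using f(1) by (metis ereal_proper_def ereal_cases)
  then have "f p \<noteq> \<infinity>"
    using min[of x0] c by auto
  then obtain b where b: "f p = ereal b"
    using f(1) by (cases "f p") (auto simp: ereal_proper_def)
  have finite_case: "b + ((1 / c) *\<^sub>R (x - p)) \<bullet> (z - p) \<le> e" if z: "f z = ereal e" for z e
  proof -
    have norm_sq: "(norm (v + t *\<^sub>R w))\<^sup>2 = (norm v)\<^sup>2 + 2 * t * (v \<bullet> w) + t\<^sup>2 * (norm w)\<^sup>2"
      for v w :: 'a and t
      unfolding power2_norm_eq_inner
      by (simp add: inner_add inner_commute[of w v] power2_eq_square algebra_simps)
    have "c * (b - e) + (x - p) \<bullet> (z - p) \<le> t * ((norm (z - p))\<^sup>2 / 2)" if t: "0 < t" "t < 1" for t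
    proof -
      define w where "w = (1 - t) *\<^sub>R p + t *\<^sub>R z"
      have "f w \<le> ereal (1 - t) * f p + ereal t * f z"
        unfolding w_def using f(2) t by (simp add: ereal_convex_def)
      then have "f w \<le> ereal ((1 - t) * b + t * e)" by (simp add: b z)
      then have "ereal c * f w + ereal ((norm (w - x))\<^sup>2 / 2)
          \<le> ereal (c * ((1 - t) * b + t * e) + (norm (w - x))\<^sup>2 / 2)"
        using c by (cases "f w") auto
      with min[of w] have "c * b + (norm (p - x))\<^sup>2 / 2 \<le> c * ((1 - t) * b + t * e) + (norm (w - x))\<^sup>2 / 2"
        unfolding b by (auto dest: order_trans)
      moreover have "w - x = (p - x) + t *\<^sub>R (z - p)" by (simp add: w_def algebra_simps)
      then have "(norm (w - x))\<^sup>2 = (norm (p - x))\<^sup>2 + 2 * t * ((p - x) \<bullet> (z - p)) + t\<^sup>2 * (norm (z - p))\<^sup>2"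
        by (simp only: norm_sq)
      moreover have "(p - x) \<bullet> (z - p) = - ((x - p) \<bullet> (z - p))"
        by (simp add: inner_diff)
      ultimately have "t * (c * (b - e) + (x - p) \<bullet> (z - p)) \<le> t * (t * ((norm (z - p))\<^sup>2 / 2))"
        by (simp add: algebra_simps power2_eq_square)
      then show ?thesis using t by simp
    qed
    then have "c * (b - e) + (x - p) \<bullet> (z - p) \<le> 0"
      by (rule nonpos_if_le_small_multiples)
    then show ?thesis
      unfolding inner_scaleR_left using c by (simp add: field_simps)
  qed
  show ?thesis
  proof (rule subdifferentialI)
    show "f p < \<infinity>" by (simp add: b)
    show "f p + ereal (((1 / c) *\<^sub>R (x - p)) \<bullet> (z - p)) \<le> f z" for z
    proof (cases "f z")
      case (real e)
      then show ?thesis using finite_case[OF real] by (simp add: b)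
    next
      case MInf
      then show ?thesis using f(1) by (simp add: ereal_proper_def)
    qed simp
  qed
qed

text \<open>The definite description \<open>prox\<close> requires a unique minimizer. Any two
  minimizers \<open>p\<close>, \<open>q\<close> yield subgradients whose monotonicity reads
  \<open>0 \<le> - (norm (q - p))\<^sup>2 / c\<close>.\<close>

lemma prox_subgradient:
  fixes f :: "'a::real_inner \<Rightarrow> ereal"
  assumes fd: "\<exists>B. finite B \<and> span B = (UNIV :: 'a set)"
    and f: "ereal_proper f" "ereal_convex f" "ereal_lsc f" and c: "c > 0"
  shows "(1 / c) *\<^sub>R (x - prox c f x) \<in> subdifferential f (prox c f x)"
proof -
  let ?min = "\<lambda>p. \<forall>z. ereal c * f p + ereal ((norm (p - x))\<^sup>2 / 2)
    \<le> ereal c * f z + ereal ((norm (z - x))\<^sup>2 / 2)"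
  note sub = prox_minimizer_subgradient[OF f(1,2) c]
  obtain p where p: "?min p" using prox_minimizer_exists[OF fd f c] by blast
  have "q = p" if q: "?min q" for q
  proof -
    have "0 \<le> ((1 / c) *\<^sub>R (x - q) - (1 / c) *\<^sub>R (x - p)) \<bullet> (q - p)"
      using sub p q by (intro subdifferential_mono[OF f(1)]) blast+
    also have "\<dots> = - ((q - p) \<bullet> (q - p)) / c"
      by (simp add: inner_diff diff_divide_distrib[symmetric] inner_commute)
    finally show ?thesis
      using c by (simp add: field_simps flip: power2_norm_eq_inner)
  qed
  with p have "prox c f x = p"
    unfolding prox_def by (rule the_equality)
  then show ?thesis using sub p by blast
qed

subsection \<open>Conjugates\<close>

lemma conjugate_ge: "ereal (u \<bullet> x) - f x \<le> conjugate f u"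
  unfolding conjugate_def by (rule SUP_upper) simp

text \<open>Equality in Fenchel-Young: the subgradient inequality says that the supremum defining
  the conjugate is attained at \<open>x\<close>.\<close>

lemma conjugate_subgradient:
  assumes "ereal_proper f" "u \<in> subdifferential f x" "f x = ereal r"
  shows "conjugate f u = ereal (u \<bullet> x - r)"
proof (rule antisym)
  show "conjugate f u \<le> ereal (u \<bullet> x - r)"
    unfolding conjugate_def
  proof (rule SUP_least)
    fix z
    show "ereal (u \<bullet> z) - f z \<le> ereal (u \<bullet> x - r)"
      using subdifferentialD(2)[OF assms(2), of z] assms(3)
      by (cases "f z") (auto simp: inner_diff)
  qed
  show "ereal (u \<bullet> x - r) \<le> conjugate f u"
    using conjugate_ge[of u x f] assms(3) by simp
qed

text \<open>Fenchel-Young is an equality at \<open>u\<close> and an inequality at \<open>v\<close>;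
  their difference is the subgradient inequality for the conjugate.\<close>

lemma subdifferential_conjugateI:
  assumes "ereal_proper f" "u \<in> subdifferential f x"
  shows "x \<in> subdifferential (conjugate f) u"
proof -
  obtain r where r: "f x = ereal r"
    using ereal_proper_finite assms subdifferentialD(1) by metis
  show ?thesis
  proof (rule subdifferentialI)
    show "conjugate f u < \<infinity>"
      by (simp add: conjugate_subgradient[OF assms r])
    show "conjugate f u + ereal (x \<bullet> (v - u)) \<le> conjugate f v" for v
      using conjugate_ge[of v x f]
      by (simp add: conjugate_subgradient[OF assms r] r inner_diff inner_commute)
  qed
qed

text \<open>The conjugate is finite at every subgradient of \<open>f\<close>, and a proximal
  residual is one.\<close>

lemma conjugate_proper:
  fixes f :: "'a::real_inner \<Rightarrow> ereal"
  assumes fd: "\<exists>B. finite B \<and> span B = (UNIV :: 'a set)"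
    and f: "ereal_proper f" "ereal_convex f" "ereal_lsc f"
  shows "ereal_proper (conjugate f)"
proof -
  obtain x a where a: "f x = ereal a"
    using f(1) by (metis ereal_proper_def ereal_cases)
  have "conjugate f u \<noteq> -\<infinity>" for u
    using conjugate_ge[of u x f] a by auto
  moreover have "conjugate f (x - prox 1 f x) < \<infinity>"
    using prox_subgradient[OF fd f, of 1 x]
    by (intro subdifferentialD(1) subdifferential_conjugateI[OF f(1)]) simp
  ultimately show ?thesis by (auto simp: ereal_proper_def)
qed

lemma conjugate_convex:
  assumes "ereal_proper f"
  shows "ereal_convex (conjugate f)"
  unfolding ereal_convex_def
proof (intro allI impI)
  fix u v and s t :: real assume st: "0 \<le> s" "0 \<le> t" "s + t = 1"
  show "conjugate f (s *\<^sub>R u + t *\<^sub>R v) \<le> ereal s * conjugate f u + ereal t * conjugate f v"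
    unfolding conjugate_def[of f "s *\<^sub>R u + t *\<^sub>R v"]
  proof (rule SUP_least)
    fix z
    have "ereal ((s *\<^sub>R u + t *\<^sub>R v) \<bullet> z) - f z
        \<le> ereal s * (ereal (u \<bullet> z) - f z) + ereal t * (ereal (v \<bullet> z) - f z)"
    proof (cases "f z")
      case (real r)
      have "(s * (u \<bullet> z) + t * (v \<bullet> z)) - (s + t) * r = s * (u \<bullet> z - r) + t * (v \<bullet> z - r)"
        by (simp add: algebra_simps)
      then show ?thesis using real st(3) by (simp add: inner_add_left)
    next
      case MInf
      then show ?thesis using assms by (simp add: ereal_proper_def)
    qed simp
    also have "\<dots> \<le> ereal s * conjugate f u + ereal t * conjugate f v"
      using st by (intro add_mono ereal_mult_left_mono conjugate_ge) auto
    finally show "ereal ((s *\<^sub>R u + t *\<^sub>R v) \<bullet> z) - f z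
        \<le> ereal s * conjugate f u + ereal t * conjugate f v" .
  qed
qed

text \<open>A supremum of affine functions: the \<open>x\<close> that witnesses a value above
  \<open>c\<close> at \<open>u\<close> also does so for all nearby \<open>v\<close>.\<close>

lemma conjugate_lsc:
  assumes "ereal_proper f"
  shows "ereal_lsc (conjugate f)"
  unfolding ereal_lsc_def le_Liminf_iff
proof (intro allI impI)
  fix u c assume "c < conjugate f u"
  then obtain x where x: "c < ereal (u \<bullet> x) - f x"
    unfolding conjugate_def less_SUP_iff by blast
  then obtain r where r: "f x = ereal r"
    using assms by (cases "f x") (auto simp: ereal_proper_def)
  have "((\<lambda>v. ereal (v \<bullet> x - r)) \<longlongrightarrow> ereal (u \<bullet> x - r)) (nhds u)"
    by (intro tendsto_intros filterlim_ident)
  then have "eventually (\<lambda>v. c < ereal (v \<bullet> x - r)) (nhds u)"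
    using x r by (intro order_tendstoD) auto
  then show "eventually (\<lambda>v. c < conjugate f v) (nhds u)"
  proof eventually_elim
    case (elim v)
    then show ?case
      using conjugate_ge[of v x f] r by (simp add: less_le_trans)
  qed
qed

text \<open>Minty's trick replaces the Fenchel--Moreau theorem: the proximal point \<open>p\<close> of \<open>x + y\<close>
  gives a second pair in the graph of the monotone operator \<open>\<partial>f\<^sup>*\<close> with the same sum,
  so the two pairs coincide.\<close>

lemma subdifferential_conjugateD:
  fixes f :: "'a::real_inner \<Rightarrow> ereal"
  assumes fd: "\<exists>B. finite B \<and> span B = (UNIV :: 'a set)"
    and f: "ereal_proper f" "ereal_convex f" "ereal_lsc f"
    and x: "x \<in> subdifferential (conjugate f) y"
  shows "y \<in> subdifferential f x"
proof -
  define p where "p = prox 1 f (x + y)"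
  have sub: "x + y - p \<in> subdifferential f p"
    unfolding p_def using prox_subgradient[OF fd f, of 1 "x + y"] by simp
  have "0 \<le> (p - x) \<bullet> (x + y - p - y)"
    using subdifferential_conjugateI[OF f(1) sub] x
    by (rule subdifferential_mono[OF conjugate_proper[OF fd f]])
  also have "\<dots> = - ((p - x) \<bullet> (p - x))"
    by (simp add: inner_diff inner_commute)
  finally have "p = x"
    by (simp flip: power2_norm_eq_inner)
  then show ?thesis using sub by simp
qed

subsection \<open>Smooth convex functions\<close>

text \<open>Riesz representation of the derivative gives existence, and uniqueness of the derivative
  justifies the definite description.\<close>

lemma gradient_GDERIV:
  fixes f :: "'a::real_inner \<Rightarrow> real"
  assumes fd: "\<exists>B. finite B \<and> span B = (UNIV :: 'a set)" and diff: "f differentiable (at u)"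
  shows "GDERIV f u :> gradient f u"
proof -
  obtain D where D: "(f has_derivative D) (at u)"
    using diff by (auto simp: differentiable_def)
  then obtain d where "\<And>x. D x = x \<bullet> d"
    using riesz_representation_finite_dim[OF fd] has_derivative_linear by metis
  then have "D = (\<lambda>x. x \<bullet> d)" by blast
  then have d: "GDERIV f u :> d"
    using D by (simp add: gderiv_def)
  moreover have "e = d" if "GDERIV f u :> e" for e
  proof -
    have "(\<lambda>x. x \<bullet> e) = (\<lambda>x. x \<bullet> d)"
      using that d unfolding gderiv_def by (rule has_derivative_unique)
    then show ?thesis using vector_eq_ldot by metis
  qed
  ultimately show ?thesis
    unfolding gradient_def by (rule theI)
qed

lemma GDERIV_along_line:
  assumes "GDERIV f (x + t *\<^sub>R d) :> e"
  shows "((\<lambda>t. f (x + t *\<^sub>R d)) has_real_derivative d \<bullet> e) (at t)"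
proof -
  have "((\<lambda>t. x + t *\<^sub>R d) has_derivative (\<lambda>s. s *\<^sub>R d)) (at t)"
    by (auto intro!: derivative_eq_intros)
  from has_derivative_compose[OF this assms[unfolded gderiv_def]]
  show ?thesis
    unfolding has_field_derivative_def by (rule has_derivative_eq_rhs) (auto simp: mult.commute)
qed

lemma descent_lemma:
  fixes f :: "'a::real_inner \<Rightarrow> real"
  assumes grad: "\<And>u. GDERIV f u :> G u" and lip: "L-lipschitz_on UNIV G"
  shows "f z \<le> f x + G x \<bullet> (z - x) + L / 2 * (norm (z - x))\<^sup>2"
proof -
  define d where "d = z - x"
  \<comment> \<open>\<open>\<psi>\<close> is \<open>f\<close> on the segment minus its quadratic
    upper model. The derivative of the last term, \<open>L * (norm d)\<^sup>2 * t\<close>, is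
    exactly the Lipschitz bound on the change of slope, so \<open>\<psi>\<close> is nonincreasing on
    \<open>[0, 1]\<close>.\<close>
  define \<psi> where "\<psi> t = f (x + t *\<^sub>R d) - t * (G x \<bullet> d) - L / 2 * (norm d)\<^sup>2 * t\<^sup>2" for t
  have "\<psi> 1 \<le> \<psi> 0"
  proof (rule DERIV_nonpos_imp_nonincreasing[where f = \<psi>])
    fix t :: real assume t: "0 \<le> t" "t \<le> 1"
    have "(\<psi> has_real_derivative d \<bullet> G (x + t *\<^sub>R d) - G x \<bullet> d - L * (norm d)\<^sup>2 * t) (at t)"
      unfolding \<psi>_def
      by (rule derivative_eq_intros GDERIV_along_line[OF grad] refl | simp)+
    moreover have "d \<bullet> G (x + t *\<^sub>R d) - G x \<bullet> d \<le> L * (norm d)\<^sup>2 * t"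
    proof -
      have "d \<bullet> G (x + t *\<^sub>R d) - G x \<bullet> d = d \<bullet> (G (x + t *\<^sub>R d) - G x)"
        by (simp add: inner_diff inner_commute)
      also have "\<dots> \<le> norm d * norm (G (x + t *\<^sub>R d) - G x)"
        by (rule norm_cauchy_schwarz)
      also have "\<dots> \<le> norm d * (L * norm (t *\<^sub>R d))"
        using lipschitz_onD[OF lip, of "x + t *\<^sub>R d" x]
        by (intro mult_left_mono) (auto simp: dist_norm)
      finally show ?thesis
        using t by (simp add: power2_eq_square mult_ac)
    qed
    ultimately show "\<exists>y. (\<psi> has_real_derivative y) (at t) \<and> y \<le> 0"
      by (intro exI conjI) (assumption, simp)
  qed simp
  then show ?thesis by (simp add: \<psi>_def d_def)
qed

text \<open>On the line through \<open>x\<close> and \<open>z\<close> this is the tangent inequality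
  for convex functions of one real variable.\<close>

lemma convex_on_gradient_le:
  fixes f :: "'a::real_inner \<Rightarrow> real"
  assumes convex: "convex_on UNIV f" and grad: "GDERIV f x :> d"
  shows "f x + d \<bullet> (z - x) \<le> f z"
proof -
  let ?\<psi> = "\<lambda>t. f (x + t *\<^sub>R (z - x))"
  have "convex_on UNIV ?\<psi>"
  proof (rule convex_onI)
    fix t a b :: real assume t: "0 < t" "t < 1"
    have "x + ((1 - t) *\<^sub>R a + t *\<^sub>R b) *\<^sub>R (z - x)
        = (1 - t) *\<^sub>R (x + a *\<^sub>R (z - x)) + t *\<^sub>R (x + b *\<^sub>R (z - x))"
      by (simp add: algebra_simps)
    then show "?\<psi> ((1 - t) *\<^sub>R a + t *\<^sub>R b) \<le> (1 - t) * ?\<psi> a + t * ?\<psi> b"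
      using convex_onD[OF convex, of t] t by simp
  qed simp
  moreover have "(?\<psi> has_real_derivative (z - x) \<bullet> d) (at 0)"
    using grad by (intro GDERIV_along_line) simp
  ultimately have "((z - x) \<bullet> d) * (1 - 0) \<le> ?\<psi> 1 - ?\<psi> 0"
    by (intro convex_on_imp_above_tangent[where A = UNIV]) auto
  then show ?thesis by (simp add: inner_commute)
qed

text \<open>The easy inclusion of the sum rule, sufficient for dual criticality.\<close>

lemma subdifferential_add_gradient:
  assumes u: "u \<in> subdifferential f x" and convex: "convex_on UNIV \<phi>" and grad: "GDERIV \<phi> x :> d"
  shows "u + d \<in> subdifferential (\<lambda>x. f x + ereal (\<phi> x)) x"
proof (rule subdifferentialI)
  show "f x + ereal (\<phi> x) < \<infinity>"
    using subdifferentialD(1)[OF u] by (cases "f x") auto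
  fix z
  have "f x + ereal (\<phi> x) + ereal ((u + d) \<bullet> (z - x))
      = (f x + ereal (u \<bullet> (z - x))) + ereal (\<phi> x + d \<bullet> (z - x))"
    by (cases "f x") (auto simp: inner_add_left)
  also have "\<dots> \<le> f z + ereal (\<phi> z)"
    using subdifferentialD(2)[OF u] convex_on_gradient_le[OF convex grad] by (intro add_mono) auto
  finally show "f x + ereal (\<phi> x) + ereal ((u + d) \<bullet> (z - x)) \<le> f z + ereal (\<phi> z)" .
qed

subsection \<open>Convergence to critical points\<close>

text \<open>\<open>P\<close> is decreasing and bounded below, hence convergent, so its successive
  differences, which dominate \<open>c * (d n)\<^sup>2\<close>, vanish.\<close>

lemma sufficient_decrease_imp_steps_to_0:
  fixes P :: "nat \<Rightarrow> real"
  assumes dec: "\<And>n. P (Suc n) + c * (d n)\<^sup>2 \<le> P n" and "c > 0" and low: "\<And>n. m \<le> P n"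
  shows "d \<longlonglongrightarrow> 0"
proof -
  have "P (Suc n) \<le> P n" for n
    using dec[of n] \<open>c > 0\<close> by (smt (verit) mult_nonneg_nonneg zero_le_power2)
  then have "decseq P" by (rule decseq_SucI)
  then obtain l where l: "P \<longlonglongrightarrow> l"
    using decseq_convergent low by metis
  have "(\<lambda>n. (P n - P (Suc n)) / c) \<longlonglongrightarrow> (l - l) / c"
    using l \<open>c > 0\<close> by (intro tendsto_intros LIMSEQ_Suc) auto
  then have lim: "(\<lambda>n. (P n - P (Suc n)) / c) \<longlonglongrightarrow> 0" by simp
  have "\<forall>n. norm ((d n)\<^sup>2) \<le> (P n - P (Suc n)) / c"
    using dec \<open>c > 0\<close> by (simp add: field_simps)
  then have "(\<lambda>n. (d n)\<^sup>2) \<longlonglongrightarrow> 0"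
    using lim by (rule Lim_null_comparison[OF always_eventually])
  then have "(\<lambda>n. sqrt ((d n)\<^sup>2)) \<longlonglongrightarrow> sqrt 0"
    by (rule tendsto_real_sqrt)
  then show ?thesis by (simp add: tendsto_rabs_zero_iff)
qed

text \<open>Passing to the conjugate of the sum inverts the first inclusion, so \<open>K x\<close>
  is the common element.\<close>

lemma primal_dual_critical_imp_dual_critical:
  assumes fd: "\<exists>B. finite B \<and> span B = (UNIV :: 'h::real_inner set)"
    and g: "ereal_proper (g :: 'h \<Rightarrow> ereal)"
    and \<phi>: "convex_on UNIV \<phi>" "\<And>u. \<phi> differentiable (at u)"
    and crit: "primal_dual_critical g \<phi> h K (x, y)"
  shows "dual_critical g \<phi> h K y"
proof -
  have "adjoint K y \<in> subdifferential (\<lambda>x. g x + ereal (\<phi> x)) x"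
    using crit subdifferential_add_gradient[OF _ \<phi>(1) gradient_GDERIV[OF fd \<phi>(2)]]
    by (auto simp: primal_dual_critical_def)
  moreover have "ereal_proper (\<lambda>x. g x + ereal (\<phi> x))"
    using g by (auto simp: ereal_proper_def)
  ultimately have "x \<in> subdifferential (conjugate (\<lambda>x. g x + ereal (\<phi> x))) (adjoint K y)"
    by (intro subdifferential_conjugateI)
  then show ?thesis
    using crit by (auto simp: primal_dual_critical_def dual_critical_def)
qed

text \<open>Inverting the second inclusion puts \<open>y\<close> into the subdifferential of
  \<open>h\<close> at \<open>K x\<close>, so \<open>adjoint K y\<close> is the common
  element.\<close>

lemma primal_dual_critical_imp_primal_critical:
  fixes h :: "'g::real_inner \<Rightarrow> ereal"
  assumes fd: "\<exists>B. finite B \<and> span B = (UNIV :: 'g set)"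
    and h: "ereal_proper h" "ereal_convex h" "ereal_lsc h"
    and crit: "primal_dual_critical g \<phi> h K (x, y)"
  shows "primal_critical g \<phi> h K x"
  using crit subdifferential_conjugateD[OF fd h]
  by (auto simp: primal_dual_critical_def primal_critical_def)

theorem proposition4:
  fixes g :: "'h::{real_inner, complete_space} \<Rightarrow> ereal"
    and h :: "'g::{real_inner, complete_space} \<Rightarrow> ereal"
    and \<phi> :: "'h \<Rightarrow> real"
    and \<beta> :: real
    and K :: "'h \<Rightarrow> 'g"
    and \<gamma> \<mu> :: "nat \<Rightarrow> real"
    and x :: "nat \<Rightarrow> 'h"
    and y :: "nat \<Rightarrow> 'g"
  assumes finite_dim_H: "\<exists>B. finite B \<and> span B = (UNIV :: 'h set)"
    and finite_dim_G: "\<exists>B. finite B \<and> span B = (UNIV :: 'g set)"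
    and g: "ereal_proper g" "ereal_convex g" "ereal_lsc g"
    and h: "ereal_proper h" "ereal_convex h" "ereal_lsc h"
    and \<phi>_convex: "convex_on UNIV \<phi>"
    and \<phi>_diff: "\<And>u. \<phi> differentiable (at u)"
    and \<beta>_pos: "\<beta> > 0"
    and \<phi>_lipschitz: "(1 / \<beta>)-lipschitz_on UNIV (gradient \<phi>)"
    and K: "linear K"
    and \<gamma>_pos: "\<And>n. \<gamma> n > 0"
    and \<mu>_pos: "\<And>n. \<mu> n > 0"
    and \<gamma>_inf: "0 < (INF n. ereal (\<gamma> n))"
    and \<gamma>_sup: "(SUP n. ereal (\<gamma> n)) < ereal (2 * \<beta>)"
    and \<mu>_inf: "0 < (INF n. ereal (\<mu> n))"
    and \<mu>_sup: "(SUP n. ereal (\<mu> n)) < \<infinity>"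
    and x_step: "\<And>n. x (Suc n) =
      prox (\<gamma> n) g (x n + \<gamma> n *\<^sub>R adjoint K (y n) - \<gamma> n *\<^sub>R gradient \<phi> (x n))"
    and y_step: "\<And>n. y (Suc n) =
      prox (\<mu> n) (conjugate h) (y n + \<mu> n *\<^sub>R K (x (Suc n)))"
    and inf_finite: "(INF u. g u + ereal (\<phi> u) - h (K u)) > -\<infinity>"
    and x_bounded: "bounded (range x)"
    and y_bounded: "bounded (range y)"
  shows "(\<forall>xb. cluster_point x xb \<longrightarrow> primal_critical g \<phi> h K xb)
    \<and> (\<forall>yb. cluster_point y yb \<longrightarrow> dual_critical g \<phi> h K yb)
    \<and> (\<forall>xb yb. cluster_point (\<lambda>n. (x n, y n)) (xb, yb)
          \<longrightarrow> primal_dual_critical g \<phi> h K (xb, yb))"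
proof -
  let ?A = "adjoint K" and ?G = "gradient \<phi>" and ?h' = "conjugate h"
  have h': "ereal_proper ?h'" "ereal_convex ?h'" "ereal_lsc ?h'"
    using conjugate_proper[OF finite_dim_G h] conjugate_convex[OF h(1)] conjugate_lsc[OF h(1)] by auto
  note adj = adjoint_works_finite_dim[OF finite_dim_H K]
  have blK: "bounded_linear K"
    by (rule bounded_linear_finite_dim[OF finite_dim_H K])
  have blA: "bounded_linear ?A"
    by (rule bounded_linear_finite_dim[OF finite_dim_G adjoint_linear_finite_dim[OF finite_dim_H K]])
  have contG: "continuous_on UNIV ?G"
    using \<phi>_lipschitz by (rule lipschitz_on_continuous_on)

  \<comment> \<open>Uniform real bounds for the step sizes\<close>
  obtain \<gamma>l where "0 < ereal \<gamma>l" and less: "ereal \<gamma>l < (INF n. ereal (\<gamma> n))"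
    using ereal_dense2[OF \<gamma>_inf] by blast
  then have \<gamma>l: "\<gamma>l > 0" "\<And>n. \<gamma>l < \<gamma> n"
    using less_INF_D[OF less] by auto
  obtain \<gamma>u where less: "(SUP n. ereal (\<gamma> n)) < ereal \<gamma>u" and "ereal \<gamma>u < ereal (2 * \<beta>)"
    using ereal_dense2[OF \<gamma>_sup] by blast
  then have \<gamma>u: "\<gamma>u < 2 * \<beta>" "\<And>n. \<gamma> n < \<gamma>u"
    using SUP_lessD[OF less] by auto
  obtain \<mu>l where "0 < ereal \<mu>l" and less: "ereal \<mu>l < (INF n. ereal (\<mu> n))"
    using ereal_dense2[OF \<mu>_inf] by blast
  then have \<mu>l: "\<mu>l > 0" "\<And>n. \<mu>l < \<mu> n"
    using less_INF_D[OF less] by auto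
  obtain \<mu>u where less: "(SUP n. ereal (\<mu> n)) < ereal \<mu>u"
    using ereal_dense2[OF \<mu>_sup] by blast
  then have \<mu>u: "\<And>n. \<mu> n < \<mu>u"
    using SUP_lessD[OF less] by auto
  have pos: "\<gamma>u > 0" "\<mu>u > 0"
    using \<gamma>u(2)[of 0] \<gamma>_pos[of 0] \<mu>u[of 0] \<mu>_pos[of 0] by auto

  \<comment> \<open>Subgradients produced by the proximal steps\<close>
  define u where "u n = (1 / \<gamma> n) *\<^sub>R (x n - x (Suc n)) + ?A (y n) - ?G (x n)" for n
  define v where "v n = (1 / \<mu> n) *\<^sub>R (y n - y (Suc n)) + K (x (Suc n))" for n
  have u: "u n \<in> subdifferential g (x (Suc n))" for n
  proof -
    have "u n = (1 / \<gamma> n) *\<^sub>R (x n + \<gamma> n *\<^sub>R ?A (y n) - \<gamma> n *\<^sub>R ?G (x n) - x (Suc n))"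
      using \<gamma>_pos[of n] by (simp add: u_def algebra_simps)
    then show ?thesis
      unfolding x_step[of n] using prox_subgradient[OF finite_dim_H g \<gamma>_pos] by simp
  qed
  have v: "v n \<in> subdifferential ?h' (y (Suc n))" for n
  proof -
    have "v n = (1 / \<mu> n) *\<^sub>R (y n + \<mu> n *\<^sub>R K (x (Suc n)) - y (Suc n))"
      using \<mu>_pos[of n] by (simp add: v_def algebra_simps)
    then show ?thesis
      unfolding y_step[of n] using prox_subgradient[OF finite_dim_G h' \<mu>_pos] by simp
  qed

  \<comment> \<open>Sufficient decrease of the primal-dual objective\<close>
  define gx where "gx n = real_of_ereal (g (x (Suc n)))" for n
  define hy where "hy n = real_of_ereal (?h' (y (Suc n)))" for n
  have gx: "g (x (Suc n)) = ereal (gx n)" for n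
    using ereal_proper_finite[OF g(1) subdifferentialD(1)[OF u]]
    unfolding gx_def by (metis real_of_ereal.simps(1))
  have hy: "?h' (y (Suc n)) = ereal (hy n)" for n
    using ereal_proper_finite[OF h'(1) subdifferentialD(1)[OF v]]
    unfolding hy_def by (metis real_of_ereal.simps(1))
  \<comment> \<open>\<open>P n\<close> is the value of \<open>\<Phi>\<close> at index
    \<open>Suc n\<close>. The shift matters: the starting point may lie outside the domains, while
    proximal outputs have finite values.\<close>
  define P where "P n = gx n + \<phi> (x (Suc n)) + hy n - y (Suc n) \<bullet> K (x (Suc n))" for n
  define dx where "dx n = norm (x (Suc n) - x n)" for n
  define dy where "dy n = norm (y (Suc n) - y n)" for n
  \<comment> \<open>The proximal step in \<open>x\<close> gains at least
    \<open>1 / \<gamma>u\<close>, the descent lemma costs \<open>1 / (2 * \<beta>)\<close>; the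
    balance is positive because \<open>\<gamma>u < 2 * \<beta>\<close>.\<close>
  define a where "a = 1 / \<gamma>u - 1 / (2 * \<beta>)"
  have a: "a > 0" unfolding a_def using \<gamma>u(1) pos \<beta>_pos by (simp add: field_simps)

  have decrease: "P (Suc n) + a * (dx (Suc n))\<^sup>2 + 1 / \<mu>u * (dy (Suc n))\<^sup>2 \<le> P n" for n
  proof -
    define p p' q q' where "p = x (Suc n)" and "p' = x (Suc (Suc n))"
      and "q = y (Suc n)" and "q' = y (Suc (Suc n))"
    have 1: "gx (Suc n) + u (Suc n) \<bullet> (p - p') \<le> gx n"
      using subdifferentialD(2)[OF u[of "Suc n"], of p] gx by (simp add: p_def p'_def)
    have 2: "hy (Suc n) + v (Suc n) \<bullet> (q - q') \<le> hy n"
      using subdifferentialD(2)[OF v[of "Suc n"], of q] hy by (simp add: q_def q'_def)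
    have 3: "\<phi> p' \<le> \<phi> p + ?G p \<bullet> (p' - p) + 1 / (2 * \<beta>) * (norm (p' - p))\<^sup>2"
      using descent_lemma[OF gradient_GDERIV[OF finite_dim_H \<phi>_diff] \<phi>_lipschitz, of p' p] by simp
    \<comment> \<open>On adding up, the gradient term cancels against the one in the descent lemma.
      The \<open>y\<close> step uses the updated \<open>p'\<close>, so
      \<open>q \<bullet> K p'\<close> cancels between 4 and 5, leaving the change of the coupling
      term.\<close>
    have 4: "u (Suc n) \<bullet> (p - p') = 1 / \<gamma> (Suc n) * (norm (p' - p))\<^sup>2
        + q \<bullet> K p - q \<bullet> K p' + ?G p \<bullet> (p' - p)"
    proof -
      have "?A q \<bullet> w = q \<bullet> K w" for w
        using adj[of w q] by (simp add: inner_commute)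
      moreover have "K (p - p') = K p - K p'"
        using K by (rule linear_diff)
      moreover have "(norm (p' - p))\<^sup>2 = (p - p') \<bullet> (p - p')"
        by (simp add: power2_norm_eq_inner inner_diff inner_commute)
      ultimately show ?thesis
        by (simp add: u_def p_def[symmetric] p'_def[symmetric] q_def[symmetric]
            inner_add_left inner_diff_left[of _ _ "p - p'"])
          (simp add: inner_diff_right)
    qed
    have 5: "v (Suc n) \<bullet> (q - q') = 1 / \<mu> (Suc n) * (norm (q' - q))\<^sup>2 + q \<bullet> K p' - q' \<bullet> K p'"
    proof -
      have "(norm (q' - q))\<^sup>2 = (q - q') \<bullet> (q - q')"
        by (simp add: power2_norm_eq_inner inner_diff inner_commute)
      then show ?thesis
        by (simp add: v_def q_def[symmetric] q'_def[symmetric] p'_def[symmetric] inner_add_left)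
          (simp add: inner_diff_right inner_commute)
    qed
    have 6: "1 / \<gamma>u * (norm (p' - p))\<^sup>2 \<le> 1 / \<gamma> (Suc n) * (norm (p' - p))\<^sup>2"
      using \<gamma>u(2)[of "Suc n"] \<gamma>_pos[of "Suc n"] by (intro mult_right_mono) (auto simp: frac_le)
    have 7: "1 / \<mu>u * (norm (q' - q))\<^sup>2 \<le> 1 / \<mu> (Suc n) * (norm (q' - q))\<^sup>2"
      using \<mu>u[of "Suc n"] \<mu>_pos[of "Suc n"] by (intro mult_right_mono) (auto simp: frac_le)
    have 8: "a * (norm (p' - p))\<^sup>2 = 1 / \<gamma>u * (norm (p' - p))\<^sup>2 - 1 / (2 * \<beta>) * (norm (p' - p))\<^sup>2"
      by (simp add: a_def left_diff_distrib)
    show ?thesis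
      unfolding P_def dx_def dy_def p_def[symmetric] p'_def[symmetric] q_def[symmetric] q'_def[symmetric]
      using 1 2 3 4 5 6 7 8 by linarith
  qed

  \<comment> \<open>Lower bound by the primal infimum\<close>
  obtain m where m: "ereal m < (INF u. g u + ereal (\<phi> u) - h (K u))"
    using ereal_dense2[OF inf_finite] by auto
  have lower: "m \<le> P n" for n
  proof -
    have "ereal m < ereal (gx n + \<phi> (x (Suc n))) - h (K (x (Suc n)))"
      using less_INF_D[OF m, of "x (Suc n)"] gx[of n] by simp
    \<comment> \<open>Fenchel-Young bounds the conjugate part of \<open>P n\<close> below by
      \<open>- h (K x)\<close>. It also excludes the value \<open>-\<infinity>\<close> of
      \<open>h\<close> at this point, and the preceding inequality excludes
      \<open>\<infinity>\<close>.\<close>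
    moreover have "ereal (y (Suc n) \<bullet> K (x (Suc n))) - h (K (x (Suc n))) \<le> ereal (hy n)"
      using conjugate_ge[of "y (Suc n)" "K (x (Suc n))" h] hy[of n] by simp
    ultimately show ?thesis
      by (cases "h (K (x (Suc n)))") (auto simp: P_def)
  qed

  \<comment> \<open>Vanishing steps\<close>
  have "(\<lambda>n. dx (Suc n)) \<longlonglongrightarrow> 0"
  proof (rule sufficient_decrease_imp_steps_to_0[OF _ a lower])
    fix n
    have "1 / \<mu>u * (dy (Suc n))\<^sup>2 \<ge> 0" using pos by simp
    then show "P (Suc n) + a * (dx (Suc n))\<^sup>2 \<le> P n" using decrease[of n] by linarith
  qed
  then have dx: "dx \<longlonglongrightarrow> 0" by (rule LIMSEQ_imp_Suc)
  have "(\<lambda>n. dy (Suc n)) \<longlonglongrightarrow> 0"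
  proof (rule sufficient_decrease_imp_steps_to_0[of _ "1 / \<mu>u", OF _ _ lower])
    fix n
    have "a * (dx (Suc n))\<^sup>2 \<ge> 0" using a by simp
    then show "P (Suc n) + 1 / \<mu>u * (dy (Suc n))\<^sup>2 \<le> P n" using decrease[of n] by linarith
  qed (use pos in simp)
  then have dy: "dy \<longlonglongrightarrow> 0" by (rule LIMSEQ_imp_Suc)

  \<comment> \<open>Passage to the limit along a joint subsequence\<close>
  have joint: "primal_dual_critical g \<phi> h K (xb, yb)"
    if r: "strict_mono r" and xr: "(x \<circ> r) \<longlonglongrightarrow> xb" and yr: "(y \<circ> r) \<longlonglongrightarrow> yb" for r xb yb
  proof -
    have dxr: "(\<lambda>n. dx (r n)) \<longlonglongrightarrow> 0" and dyr: "(\<lambda>n. dy (r n)) \<longlonglongrightarrow> 0"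
      using LIMSEQ_subseq_LIMSEQ[OF dx r] LIMSEQ_subseq_LIMSEQ[OF dy r] by (simp_all add: o_def)
    have xr': "(\<lambda>n. x (r n)) \<longlonglongrightarrow> xb" and yr': "(\<lambda>n. y (r n)) \<longlonglongrightarrow> yb"
      using xr yr by (simp_all add: o_def)
    \<comment> \<open>The subgradients with index \<open>r n\<close> belong to the iterates with
      index \<open>Suc (r n)\<close>; vanishing steps give these the same limits.\<close>
    have "(\<lambda>n. x (Suc (r n)) - x (r n)) \<longlonglongrightarrow> 0" "(\<lambda>n. y (Suc (r n)) - y (r n)) \<longlonglongrightarrow> 0"
      using dxr dyr by (simp_all add: dx_def dy_def tendsto_norm_zero_iff)
    from tendsto_add[OF this(1) xr'] tendsto_add[OF this(2) yr']
    have xs: "(\<lambda>n. x (Suc (r n))) \<longlonglongrightarrow> xb" and ys: "(\<lambda>n. y (Suc (r n))) \<longlonglongrightarrow> yb"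
      by simp_all
    \<comment> \<open>The step sizes need not converge; the lower bound \<open>\<gamma>l\<close>
      keeps their reciprocals bounded.\<close>
    have "(\<lambda>n. (1 / \<gamma> (r n)) *\<^sub>R (x (r n) - x (Suc (r n)))) \<longlonglongrightarrow> 0"
    proof (rule Lim_null_comparison[OF always_eventually])
      show "\<forall>n. norm ((1 / \<gamma> (r n)) *\<^sub>R (x (r n) - x (Suc (r n)))) \<le> 1 / \<gamma>l * dx (r n)"
      proof
        fix n
        show "norm ((1 / \<gamma> (r n)) *\<^sub>R (x (r n) - x (Suc (r n)))) \<le> 1 / \<gamma>l * dx (r n)"
          using \<gamma>l(1) \<gamma>l(2)[of "r n"] by (simp add: dx_def norm_minus_commute frac_le)
      qed
      show "(\<lambda>n. 1 / \<gamma>l * dx (r n)) \<longlonglongrightarrow> 0"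
        using dxr by (rule tendsto_mult_right_zero)
    qed
    then have "(\<lambda>n. u (r n)) \<longlonglongrightarrow> 0 + ?A yb - ?G xb"
      unfolding u_def
      by (intro tendsto_add tendsto_diff bounded_linear.tendsto[OF blA] yr'
          continuous_on_tendsto_compose[OF contG xr']) auto
    then have G: "?A yb - ?G xb \<in> subdifferential g xb"
      using subdifferential_closed_graph[OF g(1,3) _ xs u] by simp
    have "(\<lambda>n. (1 / \<mu> (r n)) *\<^sub>R (y (r n) - y (Suc (r n)))) \<longlonglongrightarrow> 0"
    proof (rule Lim_null_comparison[OF always_eventually])
      show "\<forall>n. norm ((1 / \<mu> (r n)) *\<^sub>R (y (r n) - y (Suc (r n)))) \<le> 1 / \<mu>l * dy (r n)"
      proof
        fix n
        show "norm ((1 / \<mu> (r n)) *\<^sub>R (y (r n) - y (Suc (r n)))) \<le> 1 / \<mu>l * dy (r n)"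
          using \<mu>l(1) \<mu>l(2)[of "r n"] by (simp add: dy_def norm_minus_commute frac_le)
      qed
      show "(\<lambda>n. 1 / \<mu>l * dy (r n)) \<longlonglongrightarrow> 0"
        using dyr by (rule tendsto_mult_right_zero)
    qed
    then have "(\<lambda>n. v (r n)) \<longlonglongrightarrow> 0 + K xb"
      unfolding v_def by (intro tendsto_add bounded_linear.tendsto[OF blK] xs)
    then have "K xb \<in> subdifferential ?h' yb"
      using subdifferential_closed_graph[OF h'(1,3) _ ys v] by simp
    with G show ?thesis
      by (auto simp: primal_dual_critical_def intro!: image_eqI[of _ _ "?A yb - ?G xb"])
  qed

  \<comment> \<open>The three kinds of cluster points\<close>
  have "primal_critical g \<phi> h K xb" if cluster: "cluster_point x xb" for xb
  proof -
    obtain r where r: "strict_mono r" "(x \<circ> r) \<longlonglongrightarrow> xb"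
      using cluster by (auto simp: cluster_point_def)
    have "bounded (range (y \<circ> r))"
      using y_bounded by (rule bounded_subset) auto
    then obtain yb s where s: "strict_mono s" "((y \<circ> r) \<circ> s) \<longlonglongrightarrow> yb"
      using bounded_imp_convergent_subsequence_finite_dim[OF finite_dim_G] by metis
    have "primal_dual_critical g \<phi> h K (xb, yb)"
      using joint[of "r \<circ> s"] r s LIMSEQ_subseq_LIMSEQ[OF r(2) s(1)]
      by (simp add: strict_mono_o comp_assoc)
    then show ?thesis
      by (rule primal_dual_critical_imp_primal_critical[OF finite_dim_G h])
  qed
  moreover have "dual_critical g \<phi> h K yb" if cluster: "cluster_point y yb" for yb
  proof -
    obtain r where r: "strict_mono r" "(y \<circ> r) \<longlonglongrightarrow> yb"
      using cluster by (auto simp: cluster_point_def)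
    have "bounded (range (x \<circ> r))"
      using x_bounded by (rule bounded_subset) auto
    then obtain xb s where s: "strict_mono s" "((x \<circ> r) \<circ> s) \<longlonglongrightarrow> xb"
      using bounded_imp_convergent_subsequence_finite_dim[OF finite_dim_H] by metis
    have "primal_dual_critical g \<phi> h K (xb, yb)"
      using joint[of "r \<circ> s"] r s LIMSEQ_subseq_LIMSEQ[OF r(2) s(1)]
      by (simp add: strict_mono_o comp_assoc)
    then show ?thesis
      by (rule primal_dual_critical_imp_dual_critical[OF finite_dim_H g(1) \<phi>_convex \<phi>_diff])
  qed
  moreover have "primal_dual_critical g \<phi> h K (xb, yb)"
    if cluster: "cluster_point (\<lambda>n. (x n, y n)) (xb, yb)" for xb yb
  proof -
    obtain r where "strict_mono r" "(\<lambda>n. (x (r n), y (r n))) \<longlonglongrightarrow> (xb, yb)"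
      using cluster by (auto simp: cluster_point_def o_def)
    then show ?thesis
      using joint[of r] tendsto_fst tendsto_snd by (fastforce simp: o_def)
  qed
  ultimately show ?thesis by blast
qed

end
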